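(* Let $X$ and $Y$ be real vector spaces and let $n$ be a fixed integer with $n\neq 0,\pm 1$. A function $f:X\to Y$ satisfies $$f(nx+y)+f(nx-y)=n^2f(x+y)+n^2f(x-y)+2f(nx)-2n^2f(x)-2(n^2-1)f(y)\qquad\text{for all }x,y\in X$$ if and only if there exist a unique symmetric multi-additive function $D:X\times X\times X\times X\to Y$ and a unique symmetric bi-additive function $B:X\times X\to Y$ such that $$f(x)=D(x,x,x,x)+B(x,x)\qquad\text{for all }x\in X.$$
   Context: A function of several variables between real vector spaces is multi-additive (bi-additive for two variables) if it is additive in each variable separately when the other variables are fixed. It is symmetric if it is invariant under every permutation of its arguments. *)

theory Defs
  imports Complex_Main "HOL-Combinatorics.Permutations"
begin

definition biadditive :: "('a::real_vector \<times> 'a \<Rightarrow> 'b::real_vector) \<Rightarrow> bool" where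
  "biadditive B \<longleftrightarrow>
     (\<forall>u. additive (\<lambda>x. B (x, u))) \<and>
     (\<forall>u. additive (\<lambda>x. B (u, x)))"

definition symmetric2 :: "('a \<times> 'a \<Rightarrow> 'b) \<Rightarrow> bool" where
  "symmetric2 B \<longleftrightarrow> (\<forall>u v. B (u, v) = B (v, u))"

definition multiadditive4 :: "('a::real_vector \<times> 'a \<times> 'a \<times> 'a \<Rightarrow> 'b::real_vector) \<Rightarrow> bool" where
  "multiadditive4 D \<longleftrightarrow>
     (\<forall>u v w. additive (\<lambda>x. D (x, u, v, w))) \<and>
     (\<forall>u v w. additive (\<lambda>x. D (u, x, v, w))) \<and>
     (\<forall>u v w. additive (\<lambda>x. D (u, v, x, w))) \<and>
     (\<forall>u v w. additive (\<lambda>x. D (u, v, w, x)))"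

text \<open>The four arguments are read as the values \<open>a 0, \<dots>, a 3\<close> of a sequence \<open>a\<close>;
  only these four values matter.\<close>

definition symmetric4 :: "('a \<times> 'a \<times> 'a \<times> 'a \<Rightarrow> 'b) \<Rightarrow> bool" where
  "symmetric4 D \<longleftrightarrow>
     (\<forall>(a :: nat \<Rightarrow> 'a) p. p permutes {..<4} \<longrightarrow>
        D (a (p 0), a (p 1), a (p 2), a (p 3)) = D (a 0, a 1, a 2, a 3))"

end

theory Submission imports Defs begin

text \<open>Fixing \<open>x\<close>, the equation is a linear relation between the translates of \<open>f\<close> by \<open>\<plusminus>nx\<close>, \<open>\<plusminus>x\<close>
  and \<open>0\<close>. Comparing it with its shift under \<open>x \<mapsto> x - b\<close>, \<open>y \<mapsto> y + ab\<close> cancels the term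
  \<open>f (y + ax)\<close> and turns every other one into a difference; after four such steps and one more
  difference in \<open>y\<close>, all fifth differences of \<open>f\<close> vanish. So the fourth difference is independent of the
  base point and hence additive in each increment; \<open>D\<close> is \<open>1/24\<close> of it. Since \<open>f\<close> is even, its constancy
  is exactly the equation for \<open>n = 2\<close>, and applying that equation to \<open>(x, 2y)\<close> and \<open>(y, x)\<close> gives the
  parallelogram law for \<open>f (2x) - 16 f x\<close>, which vanishes on quartic maps and is \<open>-12\<close> times a
  quadratic one; its polarization yields \<open>B\<close>. Uniqueness: scaling by \<open>2\<close> separates the
  diagonals of \<open>D\<close> and \<open>B\<close>, which determine them by polarization.\<close>

section \<open>Finite differences and the elimination of translates\<close>

definition fwd_diff :: "'a::ab_group_add \<Rightarrow> ('a \<Rightarrow> 'b::ab_group_add) \<Rightarrow> 'a \<Rightarrow> 'b" where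
  "fwd_diff h f = (\<lambda>x. f (x + h) - f x)"

text \<open>Every translate carries its own function and the right-hand side may be any function of
  \<open>x\<close> alone, so eliminating one translate leads to an equation of the same kind with a
  shorter list.\<close>

lemma fold_fwd_diff_eq_0_of_linear_equation:
  fixes L :: "(real \<times> ('a::real_vector \<Rightarrow> 'b::ab_group_add)) list"
  assumes "\<forall>(a, \<phi>)\<in>set L. a \<noteq> 0"
    and "\<And>x y. \<phi>\<^sub>0 y + (\<Sum>(a, \<phi>)\<leftarrow>L. \<phi> (y + a *\<^sub>R x)) = g x"
    and "length hs = Suc (length L)"
  shows "fold fwd_diff hs \<phi>\<^sub>0 y = 0"
  using assms
proof (induction "length L" arbitrary: L \<phi>\<^sub>0 g hs)
  case 0
  then obtain h where "hs = [h]" by (auto simp: length_Suc_conv)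
  moreover have "\<phi>\<^sub>0 u = g 0" for u using "0.prems"(2)[of u 0] "0.hyps" by simp
  ultimately show ?case by (simp add: fwd_diff_def)
next
  case (Suc m)
  obtain a \<phi> L' where L: "L = (a, \<phi>) # L'" "length L' = m"
    using Suc.hyps(2) by (cases L) auto
  obtain h hs' where hs: "hs = h # hs'" "length hs' = Suc m"
    using Suc.prems(3) L by (cases hs) auto
  have a: "a \<noteq> 0" using Suc.prems(1) L by auto
  \<comment> \<open>The shift from \<open>(x, u)\<close> to \<open>(x - b, u + h)\<close> leaves
    \<open>u + a *\<^sub>R x\<close> unchanged precisely if \<open>a *\<^sub>R b = h\<close>. The
    division makes every increment \<open>h\<close> available.\<close>
  define b where "b = h /\<^sub>R a"
  have ab: "a *\<^sub>R b = h" using a by (simp add: b_def)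
  \<comment> \<open>Under the same shift the argument \<open>u + c *\<^sub>R x\<close> moves by
    \<open>h - c *\<^sub>R b\<close>, so each remaining function becomes its difference with that
    increment while \<open>c\<close> stays.\<close>
  define M where "M = map (\<lambda>(c, \<psi>). (c, \<lambda>z. \<psi> (z + (h - c *\<^sub>R b)) - \<psi> z)) L'"
  have eq: "fwd_diff h \<phi>\<^sub>0 u + (\<Sum>(c, \<psi>)\<leftarrow>M. \<psi> (u + c *\<^sub>R x)) = g (x - b) - g x" for x u
  proof -
    have "(\<Sum>(c, \<psi>)\<leftarrow>M. \<psi> (u + c *\<^sub>R x))
        = (\<Sum>(c, \<psi>)\<leftarrow>L'. \<psi> (u + h + c *\<^sub>R (x - b))) - (\<Sum>(c, \<psi>)\<leftarrow>L'. \<psi> (u + c *\<^sub>R x))"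
      unfolding M_def by (induction L') (auto simp: algebra_simps)
    moreover have "h + a *\<^sub>R (x - b) = a *\<^sub>R x"
      by (simp add: algebra_simps ab)
    ultimately show ?thesis
      unfolding Suc.prems(2)[of "u + h" "x - b", symmetric] Suc.prems(2)[of u x, symmetric]
      by (simp add: L fwd_diff_def add.assoc)
  qed
  have "fold fwd_diff hs' (fwd_diff h \<phi>\<^sub>0) y = 0"
  proof (rule Suc.hyps(1)[of M])
    show "m = length M" by (simp add: M_def L)
    show "\<forall>(c, \<psi>)\<in>set M. c \<noteq> 0" using Suc.prems(1) by (auto simp: M_def L)
    show "length hs' = Suc (length M)" by (simp add: M_def L hs)
  qed (rule eq)
  then show ?case by (simp add: hs)
qed

lemma fwd_diff_commute: "fwd_diff h (fwd_diff k f) = fwd_diff k (fwd_diff h f)"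
  by (simp add: fwd_diff_def fun_eq_iff algebra_simps)

section \<open>Symmetry, multi-additivity and integer scalars\<close>

lemma symmetric4I:
  assumes "\<And>a b c d. D (b, a, c, d) = D (a, b, c, d)"
    and "\<And>a b c d. D (a, c, b, d) = D (a, b, c, d)"
    and "\<And>a b c d. D (a, b, d, c) = D (a, b, c, d)"
  shows "symmetric4 D"
proof -
  \<comment> \<open>The quantifier over \<open>a\<close> stays inside the induction, since the
    hypothesis for \<open>p\<close> is applied to \<open>u \<circ> transpose i j\<close>.\<close>
  have "\<forall>a. D (a (p 0), a (p 1), a (p 2), a (p 3)) = D (a 0, a 1, a 2, a 3)"
    if "p permutes {..<4::nat}" for p
    using that finite_lessThan
  proof (induction rule: permutes_induct)
    case (swap i j p)
    have *: "D (u (transpose i j 0), u (transpose i j 1), u (transpose i j 2), u (transpose i j 3))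
        = D (u 0, u 1, u 2, u 3)" for u
    proof -
      have "i \<in> {0, 1, 2, 3}" "j \<in> {0, 1, 2, 3}" using swap by auto
      \<comment> \<open>Every transposition of two of the four positions is a product of adjacent
        ones, which the assumptions cover.\<close>
      then show ?thesis
        by (auto simp: transpose_def) (metis assms)+
    qed
    show ?case
    proof
      fix u
      show "D (u ((transpose i j \<circ> p) 0), u ((transpose i j \<circ> p) 1), u ((transpose i j \<circ> p) 2),
          u ((transpose i j \<circ> p) 3)) = D (u 0, u 1, u 2, u 3)"
        using swap.IH[rule_format, of "u \<circ> transpose i j"] * by simp
    qed
  qed simp
  then show ?thesis by (simp add: symmetric4_def)
qed

lemma symmetric4D:
  assumes "symmetric4 D"
  shows "D (b, a, c, d) = D (a, b, c, d)"
    and "D (a, c, b, d) = D (a, b, c, d)"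
    and "D (a, b, d, c) = D (a, b, c, d)"
proof -
  have *: "D (u (p 0), u (p 1), u (p 2), u (p 3)) = D (u 0, u 1, u 2, u 3)"
    if "p permutes {..<4::nat}" for u p
    using assms that by (auto simp: symmetric4_def)
  let ?u = "\<lambda>i::nat. [a, b, c, d] ! i"
  show "D (b, a, c, d) = D (a, b, c, d)"
    using *[of "transpose 0 1" ?u] by (simp add: permutes_swap_id transpose_def)
  show "D (a, c, b, d) = D (a, b, c, d)"
    using *[of "transpose 1 2" ?u] by (simp add: permutes_swap_id transpose_def)
  show "D (a, b, d, c) = D (a, b, c, d)"
    using *[of "transpose 2 3" ?u] by (simp add: permutes_swap_id transpose_def)
qed

lemma multiadditive4_iff:
  "multiadditive4 D \<longleftrightarrow>
    (\<forall>x y u v w. D (x + y, u, v, w) = D (x, u, v, w) + D (y, u, v, w)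
      \<and> D (u, x + y, v, w) = D (u, x, v, w) + D (u, y, v, w)
      \<and> D (u, v, x + y, w) = D (u, v, x, w) + D (u, v, y, w)
      \<and> D (u, v, w, x + y) = D (u, v, w, x) + D (u, v, w, y))"
  by (auto simp: multiadditive4_def Modules.additive_def)

lemma biadditive_iff:
  "biadditive B \<longleftrightarrow>
    (\<forall>x y u. B (x + y, u) = B (x, u) + B (y, u) \<and> B (u, x + y) = B (u, x) + B (u, y))"
  by (auto simp: biadditive_def Modules.additive_def)

text \<open>An additive map between real vector spaces need not be real-linear, so only integer
  scalars are pulled out; this covers both \<open>n\<close> and doubling.\<close>

lemma additive_scaleR_int:
  fixes g :: "'a::real_vector \<Rightarrow> 'b::real_vector"
  assumes "additive g"
  shows "g (of_int k *\<^sub>R x) = of_int k *\<^sub>R g x"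
proof (induction k rule: int_induct[where k = 0])
  case base
  show ?case by (simp add: additive.zero[OF assms])
next
  case (step1 i)
  then show ?case by (simp add: scaleR_left_distrib additive.add[OF assms])
next
  case (step2 i)
  then show ?case by (simp add: scaleR_left_diff_distrib additive.diff[OF assms])
qed
text \<open>Turns numeral multiples into repeated sums, which reduces identities with numeral
  coefficients to cancellation in an abelian group.\<close>

lemma scaleR_numeral_simps:
  fixes v :: "'a::real_vector"
  shows "numeral (Num.Bit0 k) *\<^sub>R v = numeral k *\<^sub>R v + numeral k *\<^sub>R v"
    and "numeral (Num.Bit1 k) *\<^sub>R v = numeral k *\<^sub>R v + numeral k *\<^sub>R v + v"
    and "numeral Num.One *\<^sub>R v = v"
  by (simp_all only: numeral_Bit0 numeral_Bit1 numeral_One scaleR_left_distrib scaleR_one)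

lemma double_eq_double_iff: "u + u = v + v \<longleftrightarrow> u = (v::'a::real_vector)"
  by (metis scaleR_2 scaleR_cancel_left zero_neq_numeral)

section \<open>From the functional equation to \<open>D\<close> and \<open>B\<close>\<close>

locale quartic_quadratic =
  fixes f :: "'a::real_vector \<Rightarrow> 'b::real_vector" and n :: int
  assumes n: "n \<noteq> 0" "n \<noteq> 1" "n \<noteq> - 1"
    and eq: "\<And>x y. f (of_int n *\<^sub>R x + y) + f (of_int n *\<^sub>R x - y)
            = (of_int n)\<^sup>2 *\<^sub>R f (x + y) + (of_int n)\<^sup>2 *\<^sub>R f (x - y)
              + 2 *\<^sub>R f (of_int n *\<^sub>R x) - (2 * (of_int n)\<^sup>2) *\<^sub>R f x
              - (2 * ((of_int n)\<^sup>2 - 1)) *\<^sub>R f y"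
begin

lemma sq_ne: "(of_int n)\<^sup>2 - (1::real) \<noteq> 0"
  using n by (auto simp: power2_eq_1_iff)

lemma f_0: "f 0 = 0"
proof -
  have "(2 * ((of_int n)\<^sup>2 - 1)) *\<^sub>R f 0 = 0"
    using eq[of 0 0] by (simp add: algebra_simps scaleR_2 flip: scaleR_scaleR)
  then show ?thesis using sq_ne by simp
qed

lemma f_minus: "f (- x) = f x"
proof -
  have "((of_int n)\<^sup>2 - 1) *\<^sub>R (f x - f (- x)) = 0"
    using eq[of 0 x] by (simp add: algebra_simps scaleR_2 f_0 flip: scaleR_scaleR)
  then show ?thesis using sq_ne by simp
qed

lemma fifth_diff:
  assumes "length hs = 5"
  shows "fold fwd_diff hs f y = 0"
proof -
  let ?n = "of_int n :: real"
  \<comment> \<open>Dividing by the coefficient of \<open>f y\<close>, nonzero by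
    \<open>sq_ne\<close>, leaves \<open>f y\<close> plus four translates, hence 4 + 1
    differences.\<close>
  let ?c = "1 / (2 * (?n\<^sup>2 - 1))"
  let ?L = "[(?n, \<lambda>x. ?c *\<^sub>R f x), (- ?n, \<lambda>x. ?c *\<^sub>R f x),
    (1, \<lambda>x. ?c *\<^sub>R - (?n\<^sup>2 *\<^sub>R f x)), (-1, \<lambda>x. ?c *\<^sub>R - (?n\<^sup>2 *\<^sub>R f x))]"
  show ?thesis
  proof (rule fold_fwd_diff_eq_0_of_linear_equation[of ?L])
    show "\<forall>(a, \<phi>)\<in>set ?L. a \<noteq> 0" using n by simp
    show "length hs = Suc (length ?L)" using assms by simp
    fix x y
    have "f (y - ?n *\<^sub>R x) = f (?n *\<^sub>R x - y)" "f (y - x) = f (x - y)"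
      using f_minus[of "?n *\<^sub>R x - y"] f_minus[of "x - y"] by simp_all
    then have "f (y + ?n *\<^sub>R x) + f (y + - ?n *\<^sub>R x) - ?n\<^sup>2 *\<^sub>R f (y + 1 *\<^sub>R x)
        - ?n\<^sup>2 *\<^sub>R f (y + - 1 *\<^sub>R x) + (2 * (?n\<^sup>2 - 1)) *\<^sub>R f y
        = 2 *\<^sub>R f (?n *\<^sub>R x) - (2 * ?n\<^sup>2) *\<^sub>R f x"
      using eq[of x y] by (simp add: add.commute[of y])
    then have "?c *\<^sub>R (f (y + ?n *\<^sub>R x) + f (y + - ?n *\<^sub>R x) - ?n\<^sup>2 *\<^sub>R f (y + 1 *\<^sub>R x)
        - ?n\<^sup>2 *\<^sub>R f (y + - 1 *\<^sub>R x) + (2 * (?n\<^sup>2 - 1)) *\<^sub>R f y)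
        = ?c *\<^sub>R (2 *\<^sub>R f (?n *\<^sub>R x) - (2 * ?n\<^sup>2) *\<^sub>R f x)" by (rule arg_cong)
    moreover have "?c *\<^sub>R ((2 * (?n\<^sup>2 - 1)) *\<^sub>R f y) = f y" using sq_ne by simp
    ultimately show "f y + (\<Sum>(a, \<phi>)\<leftarrow>?L. \<phi> (y + a *\<^sub>R x))
        = ?c *\<^sub>R (2 *\<^sub>R f (?n *\<^sub>R x) - (2 * ?n\<^sup>2) *\<^sub>R f x)"
      by (simp only: scaleR_right_distrib scaleR_right_diff_distrib list.map sum_list.Cons
          sum_list.Nil case_prod_conv scaleR_minus_right add_0_right)
        (simp only: diff_conv_add_uminus add_ac)
  qed
qed

definition "polar4 a b c d = fwd_diff d (fwd_diff c (fwd_diff b (fwd_diff a f))) 0"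

lemma fourth_diff_const: "fwd_diff d (fwd_diff c (fwd_diff b (fwd_diff a f))) y = polar4 a b c d"
  \<comment> \<open>The fifth difference with last increment \<open>y\<close>, taken at 0, compares
    the fourth difference at \<open>y\<close> with that at 0.\<close>
  using fifth_diff[of "[a, b, c, d, y]" 0] by (simp add: polar4_def fwd_diff_def[of y])

lemma polar4_commute: "polar4 b a c d = polar4 a b c d" "polar4 a c b d = polar4 a b c d" "polar4 a b d c = polar4 a b c d"
  by (simp_all add: polar4_def fwd_diff_commute)

text \<open>The difference with increment \<open>x + y\<close> telescopes through \<open>y\<close>,
  and the part based at \<open>y\<close> may be moved to 0.\<close>

lemma polar4_add: "polar4 a b c (x + y) = polar4 a b c x + polar4 a b c y"
proof -
  have "polar4 a b c (x + y) = fwd_diff x (fwd_diff c (fwd_diff b (fwd_diff a f))) y + fwd_diff y (fwd_diff c (fwd_diff b (fwd_diff a f))) 0"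
    by (simp add: polar4_def fwd_diff_def add.commute)
  then show ?thesis by (simp only: fourth_diff_const)
qed

lemma polar4_diag: "polar4 x x x x = 2 *\<^sub>R f (2 *\<^sub>R x) - 8 *\<^sub>R f x"
proof -
  \<comment> \<open>The base point \<open>-2x\<close> makes the fourth difference central, so
    evenness pairs its terms.\<close>
  have "polar4 x x x x = f (x + x) - 4 *\<^sub>R f x + 6 *\<^sub>R f 0 - 4 *\<^sub>R f (- x) + f (- x - x)"
    unfolding fourth_diff_const[of x x x x "- x - x", symmetric]
    by (simp add: fwd_diff_def scaleR_numeral_simps)
  then show ?thesis using f_minus[of "x + x"] by (simp add: f_minus f_0 scaleR_numeral_simps)
qed

lemma eq2: "f (2 *\<^sub>R x + y) + f (2 *\<^sub>R x - y)
  = 4 *\<^sub>R f (x + y) + 4 *\<^sub>R f (x - y) + 2 *\<^sub>R f (2 *\<^sub>R x) - 8 *\<^sub>R f x - 6 *\<^sub>R f y"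
proof -
  have ev: "f (y - x) = f (x - y)" "f (y - (x + x)) = f (x + x - y)"
    using f_minus[of "x - y"] f_minus[of "x + x - y"] by simp_all
  \<comment> \<open>The base point \<open>y - 2x\<close> centers the same difference at
    \<open>y\<close>; \<open>polar4_diag\<close> gives its value.\<close>
  have "polar4 x x x x = f (x + x + y) - 4 *\<^sub>R f (x + y) + 6 *\<^sub>R f y - 4 *\<^sub>R f (y - x) + f (y - (x + x))"
    unfolding fourth_diff_const[of x x x x "y - x - x", symmetric]
    by (simp add: fwd_diff_def scaleR_numeral_simps algebra_simps)
  then have "f (x + x + y) - 4 *\<^sub>R f (x + y) + 6 *\<^sub>R f y - 4 *\<^sub>R f (x - y) + f (x + x - y)
      = 2 *\<^sub>R f (x + x) - 8 *\<^sub>R f x"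
    unfolding ev polar4_diag scaleR_2 by simp
  then show ?thesis
    unfolding scaleR_2[of x] by (simp add: algebra_simps)
qed

definition "quad x = f (2 *\<^sub>R x) - 16 *\<^sub>R f x"

lemma quad_parallelogram: "quad (x + y) + quad (x - y) = 2 *\<^sub>R quad x + 2 *\<^sub>R quad y"
proof -
  have ev: "f (2 *\<^sub>R y - x) = f (x - 2 *\<^sub>R y)" "f (y - x) = f (x - y)"
    using f_minus[of "x - y"] f_minus[of "x - 2 *\<^sub>R y"] by simp_all
  have "f (2 *\<^sub>R (x + y)) + f (2 *\<^sub>R (x - y))
      = 4 *\<^sub>R (f (2 *\<^sub>R y + x) + f (2 *\<^sub>R y - x)) + 2 *\<^sub>R f (2 *\<^sub>R x) - 8 *\<^sub>R f x - 6 *\<^sub>R f (2 *\<^sub>R y)"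
    using eq2[of x "2 *\<^sub>R y"]
    by (simp only: ev scaleR_right_distrib scaleR_right_diff_distrib add.commute)
  then have "f (2 *\<^sub>R (x + y)) + f (2 *\<^sub>R (x - y))
      = 16 *\<^sub>R (f (x + y) + f (x - y)) + 2 *\<^sub>R f (2 *\<^sub>R x) + 2 *\<^sub>R f (2 *\<^sub>R y) - 32 *\<^sub>R f x - 32 *\<^sub>R f y"
    unfolding eq2[of y x]
    unfolding ev add.commute[of y x]
    by (simp add: scaleR_numeral_simps algebra_simps)
  then show ?thesis
    by (simp add: quad_def algebra_simps)
qed

definition "polar2 x y = quad (x + y) - quad x - quad y"

lemma polar2_commute: "polar2 x y = polar2 y x"
  by (simp add: polar2_def add.commute)

text \<open>The Jordan-von Neumann argument: \<open>quad (x + y + z)\<close> is expanded by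
  splitting off \<open>z\<close> and by splitting off \<open>y\<close>. The two leftover terms add
  up by the parallelogram law for \<open>x\<close> and \<open>y - z\<close>, and halving expresses
  the value through pairs and single vectors.\<close>

lemma polar2_add: "polar2 (x + y) z = polar2 x z + polar2 y z"
proof -
  have 1: "quad (x + y + z) = 2 *\<^sub>R quad (x + y) + 2 *\<^sub>R quad z - quad (x + y - z)"
    using quad_parallelogram[of "x + y" z] by (simp add: algebra_simps)
  have 2: "quad (x + y + z) = 2 *\<^sub>R quad (x + z) + 2 *\<^sub>R quad y - quad (x + z - y)"
    using quad_parallelogram[of "x + z" y] by (simp add: algebra_simps)
  have 3: "quad (x + y - z) + quad (x + z - y) = 2 *\<^sub>R quad x + 2 *\<^sub>R quad (y - z)"
    using quad_parallelogram[of x "y - z"] by (simp add: algebra_simps)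
  have 4: "quad (y - z) = 2 *\<^sub>R quad y + 2 *\<^sub>R quad z - quad (y + z)"
    using quad_parallelogram[of y z] by (simp add: algebra_simps)
  have "quad (x + y + z) + quad (x + y + z)
      = 2 *\<^sub>R quad (x + y) + 2 *\<^sub>R quad z + 2 *\<^sub>R quad (x + z) + 2 *\<^sub>R quad y - (quad (x + y - z) + quad (x + z - y))"
    using 1 2 by (metis (no_types, lifting) add_diff_add add.assoc)
  also have "\<dots> = (quad (x + y) + quad (x + z) + quad (y + z) - quad x - quad y - quad z)
      + (quad (x + y) + quad (x + z) + quad (y + z) - quad x - quad y - quad z)"
    unfolding 3 4 by (simp add: scaleR_numeral_simps algebra_simps)
  finally have "quad (x + y + z) = quad (x + y) + quad (x + z) + quad (y + z) - quad x - quad y - quad z"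
    unfolding double_eq_double_iff .
  then show ?thesis by (simp add: polar2_def)
qed

lemma polar2_diag: "polar2 x x = 2 *\<^sub>R quad x"
proof -
  have "quad 0 = 0" by (simp add: quad_def f_0)
  then show ?thesis using quad_parallelogram[of x x] by (simp add: polar2_def scaleR_2 algebra_simps)
qed

lemma f_decomposition: "f x = (1/24) *\<^sub>R polar4 x x x x + (- 1/24) *\<^sub>R polar2 x x"
proof -
  \<comment> \<open>Both diagonals contain \<open>2 *\<^sub>R f (2 *\<^sub>R x)\<close>, which
    cancels; the rest is -8 + 32 = 24 times \<open>f x\<close>.\<close>
  have "24 *\<^sub>R f x = polar4 x x x x - polar2 x x"
    unfolding polar4_diag polar2_diag quad_def by (simp add: scaleR_numeral_simps algebra_simps)
  then have "(1/24) *\<^sub>R (24 *\<^sub>R f x) = (1/24) *\<^sub>R (polar4 x x x x - polar2 x x)" by (rule arg_cong)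
  then show ?thesis by (simp add: scaleR_right_diff_distrib)
qed

lemma decomposition_exists:
  "\<exists>D B. multiadditive4 D \<and> symmetric4 D \<and> biadditive B \<and> symmetric2 B \<and>
      (\<forall>x. f x = D (x, x, x, x) + B (x, x))"
proof (intro exI conjI)
  let ?D = "\<lambda>(a, b, c, d). (1/24) *\<^sub>R polar4 a b c d"
  let ?B = "\<lambda>(x, y). (- 1/24) *\<^sub>R polar2 x y"
  show "multiadditive4 ?D"
    unfolding multiadditive4_iff prod.case
    by (metis polar4_commute polar4_add scaleR_right_distrib)
  show "symmetric4 ?D" by (rule symmetric4I) (simp_all add: polar4_commute)
  show "biadditive ?B"
    unfolding biadditive_iff prod.case
    by (metis polar2_commute polar2_add scaleR_right_distrib)
  show "symmetric2 ?B" unfolding symmetric2_def prod.case by (metis polar2_commute)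
  show "\<forall>x. f x = ?D (x, x, x, x) + ?B (x, x)" using f_decomposition by simp
qed

end

section \<open>From \<open>D\<close> and \<open>B\<close> back to the functional equation\<close>

lemma multiadditive4_scaleR_int:
  assumes "multiadditive4 D"
  shows "D (of_int k *\<^sub>R a, b, c, d) = of_int k *\<^sub>R D (a, b, c, d)"
    and "D (a, of_int k *\<^sub>R b, c, d) = of_int k *\<^sub>R D (a, b, c, d)"
    and "D (a, b, of_int k *\<^sub>R c, d) = of_int k *\<^sub>R D (a, b, c, d)"
    and "D (a, b, c, of_int k *\<^sub>R d) = of_int k *\<^sub>R D (a, b, c, d)"
  using assms
    additive_scaleR_int[of "\<lambda>x. D (x, b, c, d)"] additive_scaleR_int[of "\<lambda>x. D (a, x, c, d)"]
    additive_scaleR_int[of "\<lambda>x. D (a, b, x, d)"] additive_scaleR_int[of "\<lambda>x. D (a, b, c, x)"]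
  unfolding multiadditive4_def by blast+

lemma biadditive_scaleR_int:
  assumes "biadditive B"
  shows "B (of_int k *\<^sub>R a, b) = of_int k *\<^sub>R B (a, b)"
    and "B (a, of_int k *\<^sub>R b) = of_int k *\<^sub>R B (a, b)"
  using assms additive_scaleR_int[of "\<lambda>x. B (x, b)"] additive_scaleR_int[of "\<lambda>x. B (a, x)"]
  unfolding biadditive_def by blast+

text \<open>Terms of odd degree in \<open>y\<close> cancel; the 6 arrangements of two
  \<open>x\<close> and two \<open>y\<close> agree by symmetry and occur twice, giving 12.\<close>

lemma multiadditive4_diag_add_diff:
  assumes "multiadditive4 D" "symmetric4 D"
  shows "D (x + y, x + y, x + y, x + y) + D (x - y, x - y, x - y, x - y)
    = 2 *\<^sub>R D (x, x, x, x) + 12 *\<^sub>R D (x, x, y, y) + 2 *\<^sub>R D (y, y, y, y)"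
proof -
  note add = assms(1)[unfolded multiadditive4_iff, rule_format]
  have diff: "D (a - b, u, v, w) = D (a, u, v, w) - D (b, u, v, w)"
    "D (u, a - b, v, w) = D (u, a, v, w) - D (u, b, v, w)"
    "D (u, v, a - b, w) = D (u, v, a, w) - D (u, v, b, w)"
    "D (u, v, w, a - b) = D (u, v, w, a) - D (u, v, w, b)" for a b u v w
    using add[of "a - b" b u v w] by simp_all
  \<comment> \<open>Oriented so that every \<open>x\<close> moves in front of every
    \<open>y\<close>, which collects equal mixed terms.\<close>
  have sym: "D (y, x, z, w) = D (x, y, z, w)" "D (z, y, x, w) = D (z, x, y, w)"
    "D (z, w, y, x) = D (z, w, x, y)" for z w
    using symmetric4D[OF assms(2)] by metis+
  show ?thesis
    by (simp add: add diff sym scaleR_numeral_simps)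
qed

lemma biadditive_diag_add_diff:
  assumes "biadditive B"
  shows "B (x + y, x + y) + B (x - y, x - y) = 2 *\<^sub>R B (x, x) + 2 *\<^sub>R B (y, y)"
proof -
  note add = assms(1)[unfolded biadditive_iff, rule_format]
  have diff: "B (a - b, u) = B (a, u) - B (b, u)" "B (u, a - b) = B (u, a) - B (u, b)" for a b u
    using add[of "a - b" b u] by simp_all
  show ?thesis
    by (simp add: add diff scaleR_2)
qed

lemma functional_equation_of_decomposition:
  fixes f :: "'a::real_vector \<Rightarrow> 'b::real_vector" and n :: int
  assumes D: "multiadditive4 D" "symmetric4 D" and B: "biadditive B"
    and f: "\<And>x. f x = D (x, x, x, x) + B (x, x)"
  shows "f (of_int n *\<^sub>R x + y) + f (of_int n *\<^sub>R x - y)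
            = (of_int n)\<^sup>2 *\<^sub>R f (x + y) + (of_int n)\<^sup>2 *\<^sub>R f (x - y)
              + 2 *\<^sub>R f (of_int n *\<^sub>R x) - (2 * (of_int n)\<^sup>2) *\<^sub>R f x
              - (2 * ((of_int n)\<^sup>2 - 1)) *\<^sub>R f y"
proof -
  have *: "f (u + v) + f (u - v) = 2 *\<^sub>R D (u, u, u, u) + 12 *\<^sub>R D (u, u, v, v)
      + 2 *\<^sub>R D (v, v, v, v) + (2 *\<^sub>R B (u, u) + 2 *\<^sub>R B (v, v))" for u v
    unfolding multiadditive4_diag_add_diff[OF D, symmetric] biadditive_diag_add_diff[OF B, symmetric] f
    by simp
  have "(of_int n)\<^sup>2 *\<^sub>R f (x + y) + (of_int n)\<^sup>2 *\<^sub>R f (x - y)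
      = (of_int n)\<^sup>2 *\<^sub>R (f (x + y) + f (x - y))" by (simp add: scaleR_right_distrib)
  then show ?thesis
    \<comment> \<open>\<open>*\<close> is applied to \<open>(nx, y)\<close> on the left and to
      \<open>(x, y)\<close>, times the square of \<open>n\<close>, on the right; pulling out
      \<open>n\<close> leaves the same mixed term in \<open>D\<close> on both sides.\<close>
    unfolding *
    by (simp add: f multiadditive4_scaleR_int[OF D(1)] biadditive_scaleR_int[OF B]
        algebra_simps power2_eq_square)
qed

section \<open>Polarization and uniqueness\<close>

lemma multiadditive4_eq_0_of_diag:
  assumes D: "multiadditive4 D" "symmetric4 D" and diag: "\<And>x. D (x, x, x, x) = 0"
  shows "D (a, b, c, d) = 0"
proof -
  note add = D(1)[unfolded multiadditive4_iff, rule_format]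
  have 1: "D (x, x, y, y) = 0" for x y
    using multiadditive4_diag_add_diff[OF D, of x y] by (simp add: diag)
  \<comment> \<open>Polarizes the first pair of arguments in \<open>1\<close>; the second pair
    follows in the same way below. Writing \<open>0 + 0\<close> lets
    \<open>double_eq_double_iff\<close> divide by 2.\<close>
  have 2: "D (x, z, y, y) = 0" for x y z
  proof -
    have "0 + 0 = D (x + z, x + z, y, y)" by (simp add: 1)
    also have "\<dots> = D (x, z, y, y) + D (x, z, y, y)"
      by (simp only: add) (simp add: 1 symmetric4D(1)[OF D(2), of z x])
    finally have "D (x, z, y, y) + D (x, z, y, y) = 0 + 0" ..
    then show ?thesis unfolding double_eq_double_iff .
  qed
  have "0 + 0 = D (a, b, c + d, c + d)" by (simp add: 2)
  also have "\<dots> = D (a, b, c, d) + D (a, b, c, d)"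
    by (simp only: add) (simp add: 2 symmetric4D(3)[OF D(2), of a b d c])
  finally have "D (a, b, c, d) + D (a, b, c, d) = 0 + 0" ..
  then show ?thesis unfolding double_eq_double_iff .
qed

lemma biadditive_eq_0_of_diag:
  assumes B: "biadditive B" "symmetric2 B" and diag: "\<And>x. B (x, x) = 0"
  shows "B (a, b) = 0"
proof -
  note add = B(1)[unfolded biadditive_iff, rule_format]
  have "0 + 0 = B (a + b, a + b)" by (simp add: diag)
  also have "\<dots> = B (a, b) + B (a, b)"
    using B(2)[unfolded symmetric2_def, rule_format, of b a] by (simp only: add) (simp add: diag)
  finally have "B (a, b) + B (a, b) = 0 + 0" ..
  then show ?thesis unfolding double_eq_double_iff .
qed

lemma decomposition_unique:
  assumes D: "multiadditive4 D" "symmetric4 D" and B: "biadditive B" "symmetric2 B"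
    and E: "multiadditive4 E" "symmetric4 E" and C: "biadditive C" "symmetric2 C"
    and eq: "\<And>x. D (x, x, x, x) + B (x, x) = E (x, x, x, x) + C (x, x)"
  shows "D = E" "B = C"
proof -
  define F where "F = (\<lambda>u. D u - E u)"
  define A where "A = (\<lambda>u. B u - C u)"
  have F: "multiadditive4 F" "symmetric4 F"
    using D E by (simp_all add: F_def multiadditive4_iff symmetric4_def)
  have A: "biadditive A" "symmetric2 A"
    using B C by (simp_all add: A_def biadditive_iff symmetric2_def)
  have FA: "F (x, x, x, x) = - A (x, x)" for x
    using eq[of x] by (simp add: F_def A_def algebra_simps)
  \<comment> \<open>Replacing \<open>x\<close> by \<open>2x\<close> in \<open>FA\<close> multiplies
    the \<open>F\<close> side by 16 and the \<open>A\<close> side by 4, and \<open>FA\<close> turns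
    \<open>- A\<close> back into \<open>F\<close>.\<close>
  have "16 *\<^sub>R F (x, x, x, x) = 4 *\<^sub>R F (x, x, x, x)" for x
    using FA[of "of_int 2 *\<^sub>R x"]
    unfolding multiadditive4_scaleR_int[OF F(1)] biadditive_scaleR_int[OF A(1)] by (simp add: FA)
  then have Fd: "F (x, x, x, x) = 0" for x
    using scaleR_cancel_right[of 16 _ 4] by simp
  then have Ad: "A (x, x) = 0" for x using FA[of x] by simp
  show "D = E"
  proof
    fix u show "D u = E u"
      using multiadditive4_eq_0_of_diag[OF F Fd] by (cases u) (simp add: F_def)
  qed
  show "B = C"
  proof
    fix u show "B u = C u"
      using biadditive_eq_0_of_diag[OF A Ad] by (cases u) (simp add: A_def)
  qed
qed

theorem theorem2p2:
  fixes f :: "'a::real_vector \<Rightarrow> 'b::real_vector" and n :: int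
  assumes "n \<noteq> 0" and "n \<noteq> 1" and "n \<noteq> - 1"
  shows "(\<forall>x y. f (of_int n *\<^sub>R x + y) + f (of_int n *\<^sub>R x - y)
            = (of_int n)\<^sup>2 *\<^sub>R f (x + y) + (of_int n)\<^sup>2 *\<^sub>R f (x - y)
              + 2 *\<^sub>R f (of_int n *\<^sub>R x) - (2 * (of_int n)\<^sup>2) *\<^sub>R f x
              - (2 * ((of_int n)\<^sup>2 - 1)) *\<^sub>R f y)
    \<longleftrightarrow> (\<exists>!(D, B).
          multiadditive4 D \<and> symmetric4 D \<and> biadditive B \<and> symmetric2 B \<and>
          (\<forall>x. f x = D (x, x, x, x) + B (x, x)))"
    (is "?eq \<longleftrightarrow> (\<exists>!(D, B). ?P D B)")
proof
  assume ?eq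
  then interpret quartic_quadratic f n
    using assms by unfold_locales blast+
  obtain D B where DB: "?P D B" using decomposition_exists by blast
  have "D' = D \<and> B' = B" if "?P D' B'" for D' B'
    using decomposition_unique[of D' B' D B] DB that by metis
  with DB show "\<exists>!(D, B). ?P D B" by (auto intro!: ex1I[of _ "(D, B)"])
next
  assume "\<exists>!(D, B). ?P D B"
  then obtain D B where "?P D B" by auto
  then show ?eq using functional_equation_of_decomposition[of D B f n] by blast
qed

end
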